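(* Let $\mathbb{K}$ be a field of characteristic $0$ and let $D=(b|g;f_1,f_2)=(d_{n,k})_{n,k\ge0}$ be a double almost-Riordan array with $b=\sum_k b_{2k}t^{2k}$, $g=\sum_kg_{2k}t^{2k}$ even ($b_0,g_0\ne0$) and $f_i=\sum_kf_{i,2k+1}t^{2k+1}$ odd ($f_{i,1}\neq0$), and assume an odd series $\sqrt{f_1f_2}$ of order $1$ with square $f_1f_2$ exists; let $\overline{f_{12}}$ be its compositional inverse. Then $D$ has an $A$-sequence, a $Z_1$-sequence, a $Z_2$-sequence and a $W$-sequence, and their generating functions $A(t)=\sum_k a_kt^{2k}$, $Z_1(t)=\sum_kz_{1,k}t^{2k}$, $Z_2(t)=\sum_k z_{2,k}t^{2k}$, $W(t)=\sum_kw_kt^{2k}$ are $$A(t)=\frac{t^2}{\overline{f_{12}}^2},\qquad Z_1(t)=\frac1{\overline{f_{12}}^2}\Big(1-\frac{g_0}{g(\overline{f_{12}})}\Big),$$ $$Z_2(t)=\frac{g_0f_{1,1}}{b_0}+\frac{t^2}{\overline{f_{12}}^2}-\frac{g_0f_{1,1}\,b(\overline{f_{12}})\,f_2(\overline{f_{12}})}{b_0\,\overline{f_{12}}\,g(\overline{f_{12}})},$$ $$W(t)=\frac{f_2(\overline{f_{12}})\big((1-w_0\overline{f_{12}}^2)b(\overline{f_{12}})-b_0\big)}{\overline{f_{12}}^3\,g(\overline{f_{12}})}+w_0,\qquad w_0=\frac{b_2}{b_0}.$$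
   Context: The double almost-Riordan array $(b|g;f_1,f_2)$ is the infinite lower triangular matrix $(d_{n,k})$ whose $k$-th column has generating function $b$ for $k=0$, $tg(f_1f_2)^{\ell}$ for $k=2\ell+1$, and $tgf_1(f_1f_2)^{\ell}$ for $k=2\ell+2$. With the convention $d_{n,k}=0$ for $k>n$: the $A$-sequence $(a_j)_{j\ge0}$ is a sequence with $d_{n,k}=\sum_{j\ge0}a_jd_{n-2,k+2(j-1)}$ for all $n\ge2$, $k\ge3$; the $Z_1$-sequence $(z_{1,j})$ satisfies $d_{n,1}=\sum_{j\ge0}z_{1,j}d_{n-2,2j+1}$ for $n\ge2$; the $Z_2$-sequence $(z_{2,j})$ satisfies $d_{n,2}=\sum_{j\ge0}z_{2,j}d_{n-2,2j}$ for $n\ge2$; the $W$-sequence $(w_j)$ satisfies $d_{n,0}=\sum_{j\ge0}w_jd_{n-2,2j}$ for $n\ge2$. Here $f_{1,1}=[t]f_1(t)$ and $\overline{f_{12}}(\sqrt{f_1f_2})=\sqrt{f_1f_2}(\overline{f_{12}})=t$. *)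

theory Defs
  imports
    "HOL-Computational_Algebra.Formal_Power_Series"
    "HOL-Library.Groups_Big_Fun"
begin

unbundle fps_syntax

definition even_fps :: "'a::zero fps \<Rightarrow> bool" where
  "even_fps f \<longleftrightarrow> (\<forall>n. odd n \<longrightarrow> f $ n = 0)"

definition odd_fps :: "'a::zero fps \<Rightarrow> bool" where
  "odd_fps f \<longleftrightarrow> (\<forall>n. even n \<longrightarrow> f $ n = 0)"

definition dar_column ::
  "'a::comm_ring_1 fps \<Rightarrow> 'a fps \<Rightarrow> 'a fps \<Rightarrow> 'a fps \<Rightarrow> nat \<Rightarrow> 'a fps" where
  "dar_column b g f1 f2 k =
    (if k = 0 then b
     else if odd k then fps_X * g * (f1 * f2) ^ ((k - 1) div 2)
     else fps_X * g * f1 * (f1 * f2) ^ ((k - 2) div 2))"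

definition dar_array ::
  "'a::comm_ring_1 fps \<Rightarrow> 'a fps \<Rightarrow> 'a fps \<Rightarrow> 'a fps \<Rightarrow> nat \<Rightarrow> nat \<Rightarrow> 'a" where
  "dar_array b g f1 f2 n k = dar_column b g f1 f2 k $ n"

text \<open>
  The infinite sums in the following four definitions are written with \<^const>\<open>Sum_any\<close>, the
  sum over the support. For a lower triangular array the support is finite; see
  \<open>finite_support_dar_array\<close> below.
\<close>

definition is_A_seq :: "(nat \<Rightarrow> nat \<Rightarrow> 'a::comm_ring_1) \<Rightarrow> (nat \<Rightarrow> 'a) \<Rightarrow> bool" where
  "is_A_seq d a \<longleftrightarrow>
    (\<forall>n\<ge>2. \<forall>k\<ge>3. d n k = Sum_any (\<lambda>j. a j * d (n - 2) (k + 2 * j - 2)))"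

definition is_Z1_seq :: "(nat \<Rightarrow> nat \<Rightarrow> 'a::comm_ring_1) \<Rightarrow> (nat \<Rightarrow> 'a) \<Rightarrow> bool" where
  "is_Z1_seq d z \<longleftrightarrow> (\<forall>n\<ge>2. d n 1 = Sum_any (\<lambda>j. z j * d (n - 2) (2 * j + 1)))"

definition is_Z2_seq :: "(nat \<Rightarrow> nat \<Rightarrow> 'a::comm_ring_1) \<Rightarrow> (nat \<Rightarrow> 'a) \<Rightarrow> bool" where
  "is_Z2_seq d z \<longleftrightarrow> (\<forall>n\<ge>2. d n 2 = Sum_any (\<lambda>j. z j * d (n - 2) (2 * j)))"

definition is_W_seq :: "(nat \<Rightarrow> nat \<Rightarrow> 'a::comm_ring_1) \<Rightarrow> (nat \<Rightarrow> 'a) \<Rightarrow> bool" where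
  "is_W_seq d w \<longleftrightarrow> (\<forall>n\<ge>2. d n 0 = Sum_any (\<lambda>j. w j * d (n - 2) (2 * j)))"

text \<open>The generating function is taken in \<open>t\<^sup>2\<close>: the coefficient of \<open>t\<^sup>2\<^sup>k\<close> is \<open>c k\<close>.\<close>

definition even_gf :: "(nat \<Rightarrow> 'a::zero) \<Rightarrow> 'a fps" where
  "even_gf c = Abs_fps (\<lambda>n. if even n then c (n div 2) else 0)"

lemma fps_X_power_dvd_imp_nth_eq_0:
  fixes f :: "'a::comm_ring_1 fps"
  assumes "fps_X ^ k dvd f" "n < k"
  shows "f $ n = 0"
  using assms by (auto elim!: dvdE simp: fps_X_power_mult_nth)

lemma dar_array_eq_0:
  fixes b g f1 f2 :: "'a::comm_ring_1 fps"
  assumes "f1 $ 0 = 0" "f2 $ 0 = 0" "n < k"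
  shows "dar_array b g f1 f2 n k = 0"
proof -
  have X: "fps_X dvd f" if "f $ 0 = 0" for f :: "'a fps"
  proof
    show "f = fps_X * fps_shift 1 f"
      using that by (intro fps_ext) (auto simp: fps_X_mult_nth)
  qed
  have 2: "fps_X ^ (2 * l) dvd (f1 * f2) ^ l" for l
    using mult_dvd_mono[OF X[OF assms(1)] X[OF assms(2)]]
    by (simp add: power_mult power2_eq_square dvd_power_same)
  have "fps_X ^ k dvd dar_column b g f1 f2 k"
  proof (cases "odd k")
    case True
    then obtain l where k: "k = 2 * l + 1" by (elim oddE)
    have "fps_X * fps_X ^ (2 * l) dvd fps_X * g * (f1 * f2) ^ l"
      by (intro mult_dvd_mono 2) simp
    with k show ?thesis by (simp add: dar_column_def)
  next
    case False
    with assms(3) obtain l where k: "k = 2 * l + 2"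
      by (metis Suc_1 add_Suc_right even_two_times_div_two evenE mult_Suc_right
          not_less_zero old.nat.exhaust add.commute mult_0_right)
    have "(fps_X * fps_X) * fps_X ^ (2 * l) dvd fps_X * g * f1 * (f1 * f2) ^ l"
      by (intro mult_dvd_mono 2 X assms) simp
    with k show ?thesis by (simp add: dar_column_def mult.assoc)
  qed
  then show ?thesis
    unfolding dar_array_def using assms(3) by (rule fps_X_power_dvd_imp_nth_eq_0)
qed

lemma finite_support_dar_array:
  fixes b g f1 f2 :: "'a::comm_ring_1 fps" and c :: "nat \<Rightarrow> 'a"
  assumes "f1 $ 0 = 0" "f2 $ 0 = 0" "\<And>j. j \<le> h j + 1"
  shows "finite {j. c j * dar_array b g f1 f2 n (h j) \<noteq> 0}"
proof (rule finite_subset)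
  show "{j. c j * dar_array b g f1 f2 n (h j) \<noteq> 0} \<subseteq> {..n + 1}"
  proof (rule subsetI, rule ccontr)
    fix j assume j: "j \<in> {j. c j * dar_array b g f1 f2 n (h j) \<noteq> 0}" "j \<notin> {..n + 1}"
    then have "n < h j" using assms(3)[of j] by auto
    with j assms show False by (simp add: dar_array_eq_0)
  qed
qed simp

end

theory Submission
  imports Defs
begin

text \<open>
  The columns of equal parity from some point on are \<open>P * s\<^sup>2\<^sup>j\<close>, so a row recurrence with
  coefficients \<open>c\<close> says exactly that a column, apart from its first two entries, is
  \<open>t\<^sup>2 P * C(s)\<close>, where \<open>C\<close> is the even generating function of \<open>c\<close>. Substituting \<open>h\<close>, the
  compositional inverse of \<open>s\<close>, solves for \<open>C\<close>. Conversely every even series is of the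
  form \<open>C(s)\<close> with \<open>C\<close> even because \<open>s\<close> is odd, which gives existence. In the recurrences for
  \<open>Z\<^sub>2\<close> and \<open>W\<close> column 0 is exceptional, so there the coefficient with index 0 is split off; row 2
  determines it.
\<close>

section \<open>Parity of series and even generating functions\<close>

text \<open>Phrasing parity as invariance under t -> -t turns it into an identity that passes
  through products, quotients and compositions. Characteristic 0 makes a coefficient equal to its
  own negative vanish.\<close>

lemma even_fps_iff_compose_uminus_X:
  fixes f :: "'a::field_char_0 fps"
  shows "even_fps f \<longleftrightarrow> f oo - fps_X = f"
  by (force simp: even_fps_def fps_compose_uminus' fps_eq_iff minus_one_power_iff)

lemma odd_fps_iff_compose_uminus_X:
  fixes f :: "'a::field_char_0 fps"
  shows "odd_fps f \<longleftrightarrow> f oo - fps_X = - f"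
  by (force simp: odd_fps_def fps_compose_uminus' fps_eq_iff minus_one_power_iff)

lemma even_gf_of_even_fps:
  assumes "even_fps f"
  shows "even_gf (\<lambda>k. f $ (2 * k)) = f"
  using assms by (auto simp: even_fps_def even_gf_def fps_eq_iff)

lemma even_gf_Suc:
  fixes c :: "nat \<Rightarrow> 'a::comm_ring_1"
  shows "even_gf c = fps_const (c 0) + fps_X ^ 2 * even_gf (\<lambda>j. c (Suc j))"
proof (rule fps_ext)
  fix n
  show "even_gf c $ n = (fps_const (c 0) + fps_X ^ 2 * even_gf (\<lambda>j. c (Suc j))) $ n"
  proof (cases "n < 2")
    case True
    then show ?thesis
      by (auto simp: even_gf_def fps_X_power_mult_nth less_2_cases_iff)
  next
    case False
    then obtain m where "n = m + 2"
      using le_Suc_ex[of 2 n] by (auto simp: add.commute)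
    then show ?thesis
      by (auto simp: even_gf_def fps_X_power_mult_nth)
  qed
qed

text \<open>The only candidate is \<open>f oo fps_inv s\<close>. Its evenness can be tested after
  composing with \<open>s\<close>, since composition on the right with \<open>s\<close> is
  injective; there, oddness of \<open>s\<close> moves the sign change onto \<open>f\<close>.\<close>

lemma ex_even_gf_compose:
  fixes s f :: "'a::field_char_0 fps"
  assumes "odd_fps s" "s $ 1 \<noteq> 0" "even_fps f"
  shows "\<exists>c. even_gf c oo s = f"
proof -
  have s0: "s $ 0 = 0"
    using assms(1) by (simp add: odd_fps_def)
  define F where "F = f oo fps_inv s"
  have Fs: "F oo s = f"
    using fps_inv[OF s0 assms(2)] s0
    by (simp add: F_def fps_compose_assoc[symmetric] fps_inv_def)
  have "(F oo - fps_X) oo s = F oo (- fps_X oo s)"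
    by (simp add: fps_compose_assoc s0)
  also have "\<dots> = F oo (s oo - fps_X)"
    using assms(1) by (simp add: fps_compose_uminus s0 odd_fps_iff_compose_uminus_X)
  also have "\<dots> = f oo - fps_X"
    by (simp add: fps_compose_assoc s0 Fs)
  also have "\<dots> = F oo s"
    using assms(3) by (simp add: even_fps_iff_compose_uminus_X Fs)
  finally have "F oo - fps_X = F"
    using fps_compose_inj_right[OF s0 assms(2)] by blast
  then show ?thesis
    using Fs even_gf_of_even_fps even_fps_iff_compose_uminus_X by metis
qed

section \<open>Row sums as coefficients of compositions\<close>

text \<open>Since \<open>s\<close> has no constant term, \<open>s ^ i\<close> has order at least
  \<open>i\<close>. One cutoff \<open>N\<close> therefore serves all coefficients up to
  \<open>N\<close>, and with a common range the two sums can be swapped.\<close>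

lemma fps_mult_compose_nth:
  fixes P F s :: "'a::comm_ring_1 fps"
  assumes "s $ 0 = 0" "n \<le> N"
  shows "(P * (F oo s)) $ n = (\<Sum>i\<le>N. F $ i * (P * s ^ i) $ n)"
proof -
  have "(F oo s) $ m = (\<Sum>i\<le>N. F $ i * (s ^ i) $ m)" if "m \<le> N" for m
    unfolding fps_compose_nth using that
    by (intro sum.mono_neutral_left)
       (auto simp: startsby_zero_power_prefix[OF assms(1), rule_format])
  then have "(P * (F oo s)) $ n = (\<Sum>k=0..n. \<Sum>i\<le>N. F $ i * (P $ k * (s ^ i) $ (n - k)))"
    using assms(2) by (simp add: fps_mult_nth sum_distrib_left mult.left_commute)
  also have "\<dots> = (\<Sum>i\<le>N. F $ i * (P * s ^ i) $ n)"
    by (subst sum.swap) (simp add: fps_mult_nth sum_distrib_left)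
  finally show ?thesis .
qed

lemma sum_even_gf:
  fixes c :: "nat \<Rightarrow> 'a::comm_ring_1"
  shows "(\<Sum>i\<le>2 * M. even_gf c $ i * u i) = (\<Sum>j\<le>M. c j * u (2 * j))"
  by (induction M) (simp_all add: even_gf_def)

lemma finite_support_power:
  fixes P s :: "'a::comm_ring_1 fps"
  assumes "s $ 0 = 0"
  shows "{j. c j * (P * (s ^ 2) ^ j) $ n \<noteq> 0} \<subseteq> {..n}"
proof -
  have "(P * (s ^ 2) ^ j) $ n = 0" if "n < j" for j
    unfolding fps_mult_nth power_mult[symmetric] using that
    by (intro sum.neutral) (auto simp: startsby_zero_power_prefix[OF assms, rule_format])
  then show ?thesis
    by (force simp: not_less[symmetric])
qed

text \<open>This is the bridge from recurrences to series: summing over columns that form a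
  geometric progression with ratio \<open>s ^ 2\<close> amounts to substituting \<open>s\<close>
  into the even generating function of the coefficients.\<close>

lemma Sum_any_power_eq_compose:
  fixes P s :: "'a::comm_ring_1 fps"
  assumes "s $ 0 = 0"
  shows "Sum_any (\<lambda>j. c j * (P * (s ^ 2) ^ j) $ n) = (P * (even_gf c oo s)) $ n"
proof -
  have "Sum_any (\<lambda>j. c j * (P * (s ^ 2) ^ j) $ n) = (\<Sum>j\<le>n. c j * (P * s ^ (2 * j)) $ n)"
    unfolding power_mult
    by (rule Sum_any.expand_superset) (simp_all add: finite_support_power[OF assms])
  also have "\<dots> = (\<Sum>i\<le>2 * n. even_gf c $ i * (P * s ^ i) $ n)"
    by (simp add: sum_even_gf)
  also have "\<dots> = (P * (even_gf c oo s)) $ n"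
    by (rule fps_mult_compose_nth[symmetric]) (use assms in auto)
  finally show ?thesis .
qed

text \<open>Finiteness matters because \<open>Sum_any\<close> is 0 by default on an infinite
  support, which would lose the term \<open>u 0\<close>.\<close>

lemma Sum_any_split_0:
  fixes u :: "nat \<Rightarrow> 'a::comm_monoid_add"
  assumes "finite {j. u (Suc j) \<noteq> 0}"
  shows "Sum_any u = u 0 + Sum_any (\<lambda>j. u (Suc j))"
proof -
  obtain N where N: "{j. u (Suc j) \<noteq> 0} \<subseteq> {..N}"
    using assms finite_nat_set_iff_bounded_le by (metis atMost_iff mem_Collect_eq subsetI)
  have "{j. u j \<noteq> 0} \<subseteq> {..Suc N}"
  proof
    fix j
    assume "j \<in> {j. u j \<noteq> 0}"
    then show "j \<in> {..Suc N}"
      using N by (cases j) auto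
  qed
  then have "Sum_any u = (\<Sum>j\<le>Suc N. u j)"
    by (intro Sum_any.expand_superset) auto
  moreover have "Sum_any (\<lambda>j. u (Suc j)) = (\<Sum>j\<le>N. u (Suc j))"
    using N by (intro Sum_any.expand_superset) auto
  ultimately show ?thesis
    by (simp only: sum.atMost_Suc_shift)
qed

text \<open>The recurrences start in row 2, so rows 0 and 1 of a column are unconstrained and appear
  as the two correction terms.\<close>

lemma nth_eq_shift_2_iff:
  fixes F G :: "'a::comm_ring_1 fps"
  shows "(\<forall>n\<ge>2. F $ n = G $ (n - 2)) \<longleftrightarrow>
    F = fps_const (F $ 0) + fps_const (F $ 1) * fps_X + fps_X ^ 2 * G"
proof -
  have "F $ n = (fps_const (F $ 0) + fps_const (F $ 1) * fps_X + fps_X ^ 2 * G) $ n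
      \<longleftrightarrow> (n \<ge> 2 \<longrightarrow> F $ n = G $ (n - 2))" for n
  proof (cases "n < 2")
    case True
    then have "n = 0 \<or> n = 1" by auto
    with True show ?thesis by (auto simp: fps_X_power_mult_nth)
  qed (auto simp: fps_X_power_mult_nth fps_X_nth)
  then show ?thesis
    unfolding fps_eq_iff by blast
qed

section \<open>The array and its columns\<close>

locale double_almost_Riordan =
  fixes b g f1 f2 s :: "'a::field_char_0 fps"
  assumes even_b: "even_fps b" and b0: "b $ 0 \<noteq> 0"
    and even_g: "even_fps g" and g0: "g $ 0 \<noteq> 0"
    and odd_f1: "odd_fps f1" and f11: "f1 $ 1 \<noteq> 0"
    and odd_f2: "odd_fps f2" and f21: "f2 $ 1 \<noteq> 0"
    and odd_s: "odd_fps s" and subdegree_s: "subdegree s = 1"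
    and s_square: "s ^ 2 = f1 * f2"
begin

abbreviation "d \<equiv> dar_array b g f1 f2"
abbreviation "h \<equiv> fps_inv s"

lemma s_nth: "s $ 0 = 0" "s $ 1 \<noteq> 0"
  using odd_s subdegree_s nth_subdegree_nonzero[of s] by (cases "s = 0"; simp add: odd_fps_def)+

lemma f_nth_0: "f1 $ 0 = 0" "f2 $ 0 = 0"
  using odd_f1 odd_f2 by (auto simp: odd_fps_def)

lemma nonzero: "b \<noteq> 0" "g \<noteq> 0" "f1 \<noteq> 0" "f2 \<noteq> 0" "s \<noteq> 0"
  using b0 g0 f11 f21 s_nth by auto

lemma subdegree_f1: "subdegree f1 = 1"
  using f11 f_nth_0 by (intro subdegreeI) auto

lemma subdegree_g: "subdegree g = 0"
  using g0 by simp

lemma h_nth_0: "h $ 0 = 0"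
  by (simp add: fps_inv_def)

lemma s_compose_h: "s oo h = fps_X"
  using s_nth by (intro fps_inv_right)

lemma h_nonzero: "h \<noteq> 0"
  using s_compose_h s_nth by auto

lemma g_compose_h_nonzero: "g oo h \<noteq> 0"
  using g0 by (metis fps_compose_nth_0 fps_zero_nth)

text \<open>This is what solves for an unknown series \<open>F\<close> that occurs only as
  \<open>F oo s\<close>.\<close>

lemma compose_s_h: "(F oo s) oo h = F"
  by (simp add: fps_compose_assoc[symmetric] s_compose_h s_nth h_nth_0)

lemmas compose_h_simps = fps_compose_mult_distrib[OF h_nth_0] fps_compose_power[OF h_nth_0, symmetric]
  fps_compose_add_distrib fps_compose_sub_distrib compose_s_h s_compose_h
  fps_X_fps_compose_startby0[OF h_nth_0]

lemma compose_h_cong: "F = G \<Longrightarrow> F oo h = G oo h"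
  by simp

lemma column_odd: "dar_column b g f1 f2 (Suc (2 * l)) = fps_X * g * (s ^ 2) ^ l"
  by (simp add: dar_column_def s_square)

lemma column_even: "dar_column b g f1 f2 (2 * Suc l) = fps_X * g * f1 * (s ^ 2) ^ l"
  by (simp add: dar_column_def s_square)

lemma column_0: "dar_column b g f1 f2 0 = b"
  by (simp add: dar_column_def)

text \<open>The factor \<open>P\<close> is column \<open>k - 2\<close>. The bound on
  \<open>k\<close> keeps this column away from the exceptional column 0.\<close>

lemma column_ge_3:
  assumes "k \<ge> 3"
  obtains P where "P \<noteq> 0" "dar_column b g f1 f2 k = P * s ^ 2"
    "\<And>j. dar_column b g f1 f2 (k + 2 * j - 2) = P * (s ^ 2) ^ j"
proof (cases "odd k")
  case True
  then obtain m where m: "k = Suc (2 * m)" by (metis oddE Suc_eq_plus1)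
  with assms obtain l where l: "k = Suc (2 * Suc l)" by (cases m) auto
  show thesis
  proof (rule that)
    show "fps_X * g * (s ^ 2) ^ l \<noteq> 0"
      using nonzero by simp
    show "dar_column b g f1 f2 k = fps_X * g * (s ^ 2) ^ l * s ^ 2"
      unfolding l column_odd by (simp add: algebra_simps)
    fix j
    have "k + 2 * j - 2 = Suc (2 * (l + j))" using l by simp
    then show "dar_column b g f1 f2 (k + 2 * j - 2) = fps_X * g * (s ^ 2) ^ l * (s ^ 2) ^ j"
      by (simp only: column_odd power_add mult.assoc)
  qed
next
  case False
  then obtain m where m: "k = 2 * m" by (metis evenE)
  with assms obtain l where l: "k = 2 * Suc (Suc l)"
    using that[of "m - 2"] by simp
  show thesis
  proof (rule that)
    show "fps_X * g * f1 * (s ^ 2) ^ l \<noteq> 0"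
      using nonzero by simp
    show "dar_column b g f1 f2 k = fps_X * g * f1 * (s ^ 2) ^ l * s ^ 2"
      unfolding l column_even by (simp add: algebra_simps)
    fix j
    have "k + 2 * j - 2 = 2 * Suc (l + j)" using l by simp
    then show "dar_column b g f1 f2 (k + 2 * j - 2) = fps_X * g * f1 * (s ^ 2) ^ l * (s ^ 2) ^ j"
      by (simp only: column_even power_add mult.assoc)
  qed
qed

section \<open>The recurrences as series identities\<close>

text \<open>For each \<open>k\<close> the nonzero factor \<open>P\<close> cancels, so all columns
  from 3 on impose one and the same condition.\<close>

lemma is_A_seq_iff: "is_A_seq d a \<longleftrightarrow> s ^ 2 = fps_X ^ 2 * (even_gf a oo s)"
proof -
  have "(\<forall>n\<ge>2. d n k = Sum_any (\<lambda>j. a j * d (n - 2) (k + 2 * j - 2)))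
      \<longleftrightarrow> s ^ 2 = fps_X ^ 2 * (even_gf a oo s)" if k: "k \<ge> 3" for k
  proof -
    from column_ge_3[OF k] obtain P where P: "P \<noteq> 0" "dar_column b g f1 f2 k = P * s ^ 2"
      "\<And>j. dar_column b g f1 f2 (k + 2 * j - 2) = P * (s ^ 2) ^ j"
      by blast
    \<comment> \<open>Column \<open>k\<close> starts no earlier than row \<open>k\<close>, so both
      correction terms vanish.\<close>
    have z: "(P * s ^ 2) $ 0 = 0" "(P * s ^ 2) $ 1 = 0"
      using dar_array_eq_0[OF f_nth_0, of 0 k b g] dar_array_eq_0[OF f_nth_0, of 1 k b g] k
      unfolding dar_array_def P(2) by linarith+
    have "P * s ^ 2 = fps_X ^ 2 * (P * (even_gf a oo s))
        \<longleftrightarrow> P * s ^ 2 = P * (fps_X ^ 2 * (even_gf a oo s))"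
      by (simp only: mult.left_commute)
    then show ?thesis
      using P(1)
      by (simp add: dar_array_def P Sum_any_power_eq_compose[OF s_nth(1)] nth_eq_shift_2_iff z
          del: One_nat_def fps_mult_nth_0)
  qed
  then show ?thesis
    unfolding is_A_seq_def by blast
qed

lemma is_Z1_seq_iff:
  "is_Z1_seq d z \<longleftrightarrow> g = fps_const (g $ 0) + fps_X ^ 2 * g * (even_gf z oo s)"
proof -
  have "is_Z1_seq d z \<longleftrightarrow>
      (\<forall>n\<ge>2. (fps_X * g) $ n = (fps_X * g * (even_gf z oo s)) $ (n - 2))"
    using column_odd[of 0]
    by (simp add: is_Z1_seq_def dar_array_def column_odd Sum_any_power_eq_compose[OF s_nth(1)])
  also have "\<dots> \<longleftrightarrow> fps_X * g =
      fps_X * (fps_const (g $ 0) + fps_X ^ 2 * g * (even_gf z oo s))"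
    unfolding nth_eq_shift_2_iff by (simp add: algebra_simps)
  finally show ?thesis by simp
qed

text \<open>Column 0 is \<open>b\<close> and does not fit the progression of columns 2, 4, ..., so
  its term is split off and the remaining coefficients are shifted by one.\<close>

lemma Sum_any_even_columns:
  "Sum_any (\<lambda>j. c j * d n (2 * j)) =
    (fps_const (c 0) * b + fps_X * g * f1 * (even_gf (\<lambda>j. c (Suc j)) oo s)) $ n"
proof -
  have fin: "finite {j. c (Suc j) * d n (2 * Suc j) \<noteq> 0}"
    by (rule finite_support_dar_array) (use f_nth_0 in auto)
  have "Sum_any (\<lambda>j. c j * d n (2 * j)) =
      c 0 * d n (2 * 0) + Sum_any (\<lambda>j. c (Suc j) * d n (2 * Suc j))"
    by (rule Sum_any_split_0) (rule fin)
  then show ?thesis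
    by (simp only: dar_array_def column_even Sum_any_power_eq_compose[OF s_nth(1)])
       (simp add: column_0)
qed

lemma is_Z2_seq_iff:
  "is_Z2_seq d z \<longleftrightarrow> g * f1 =
    fps_X * (fps_const (z 0) * b) + fps_X ^ 2 * g * f1 * (even_gf (\<lambda>j. z (Suc j)) oo s)"
proof -
  have "is_Z2_seq d z \<longleftrightarrow> (\<forall>n\<ge>2. (fps_X * g * f1) $ n =
      (fps_const (z 0) * b + fps_X * g * f1 * (even_gf (\<lambda>j. z (Suc j)) oo s)) $ (n - 2))"
    unfolding is_Z2_seq_def Sum_any_even_columns using column_even[of 0] by (simp add: dar_array_def)
  also have "\<dots> \<longleftrightarrow> fps_X * (g * f1) = fps_X *
      (fps_X * (fps_const (z 0) * b) + fps_X ^ 2 * g * f1 * (even_gf (\<lambda>j. z (Suc j)) oo s))"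
    unfolding nth_eq_shift_2_iff
    by (simp add: algebra_simps power2_eq_square f_nth_0)
  finally show ?thesis by simp
qed

lemma is_W_seq_iff:
  "is_W_seq d w \<longleftrightarrow> b = fps_const (b $ 0) +
    fps_X ^ 2 * (fps_const (w 0) * b + fps_X * g * f1 * (even_gf (\<lambda>j. w (Suc j)) oo s))"
proof -
  have "b $ 1 = 0" using even_b by (simp add: even_fps_def)
  moreover have "is_W_seq d w \<longleftrightarrow> (\<forall>n\<ge>2. b $ n =
      (fps_const (w 0) * b + fps_X * g * f1 * (even_gf (\<lambda>j. w (Suc j)) oo s)) $ (n - 2))"
    unfolding is_W_seq_def Sum_any_even_columns by (simp add: dar_array_def column_0)
  ultimately show ?thesis
    unfolding nth_eq_shift_2_iff by simp
qed

section \<open>Existence of the four sequences\<close>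

text \<open>Comparing orders gives divisibility, and a quotient of two series of equal parity is
  even, hence an even series evaluated at \<open>s\<close>.\<close>

lemma ex_even_quotient:
  assumes "subdegree p \<le> n" "\<And>i. i < n \<Longrightarrow> q $ i = 0" "p \<noteq> 0"
    and "(even_fps p \<and> even_fps q) \<or> (odd_fps p \<and> odd_fps q)"
  shows "\<exists>c. q = p * (even_gf c oo s)"
proof -
  have "p dvd q"
  proof (cases "q = 0")
    case False
    then have "n \<le> subdegree q"
      using assms(2) by (intro subdegree_geI)
    then show ?thesis
      using assms False by (simp add: fps_dvd_iff)
  qed simp
  then obtain r where r: "q = p * r" by (elim dvdE)
  have "q oo - fps_X = (p oo - fps_X) * (r oo - fps_X)"
    unfolding r by (rule fps_compose_mult_distrib) simp
  then have "p * r = p * (r oo - fps_X)"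
    using assms(4) unfolding even_fps_iff_compose_uminus_X odd_fps_iff_compose_uminus_X
    by (auto simp: r)
  then have "even_fps r"
    using assms(3) by (simp add: even_fps_iff_compose_uminus_X)
  then show ?thesis
    using ex_even_gf_compose[OF odd_s s_nth(2)] r by metis
qed

lemma uminus_X_nth_0: "(- fps_X :: 'a fps) $ 0 = 0"
  by simp

lemmas compose_uminus_X_simps = fps_compose_mult_distrib[OF uminus_X_nth_0]
  fps_compose_power[OF uminus_X_nth_0, symmetric] fps_compose_add_distrib fps_compose_sub_distrib
  fps_X_fps_compose_startby0[OF uminus_X_nth_0]
  iffD1[OF even_fps_iff_compose_uminus_X even_b] iffD1[OF even_fps_iff_compose_uminus_X even_g]
  iffD1[OF odd_fps_iff_compose_uminus_X odd_f1] iffD1[OF odd_fps_iff_compose_uminus_X odd_s]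

lemma ex_A_seq: "\<exists>a. is_A_seq d a"
  unfolding is_A_seq_iff
proof (rule ex_even_quotient[where n = 2])
  show "(s ^ 2) $ i = 0" if "i < 2" for i
    using startsby_zero_power_prefix[OF s_nth(1)] that by blast
qed (simp_all add: even_fps_iff_compose_uminus_X compose_uminus_X_simps fps_X_power_subdegree)

lemma ex_Z1_seq: "\<exists>z. is_Z1_seq d z"
proof -
  have "\<exists>z. g - fps_const (g $ 0) = (fps_X ^ 2 * g) * (even_gf z oo s)"
  proof (rule ex_even_quotient[where n = 2])
    show "(g - fps_const (g $ 0)) $ i = 0" if "i < 2" for i
      using that even_g by (auto simp: less_2_cases_iff even_fps_def)
  qed (use nonzero in \<open>simp_all add: even_fps_iff_compose_uminus_X compose_uminus_X_simps
      subdegree_g fps_X_power_subdegree\<close>)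
  then show ?thesis
    unfolding is_Z1_seq_iff by (simp add: algebra_simps)
qed

lemma ex_Z2_seq: "\<exists>z. is_Z2_seq d z"
proof -
  \<comment> \<open>This value cancels the coefficient of t. The difference below is odd, so it then
    has order at least 3, the order of \<open>fps_X ^ 2 * g * f1\<close>.\<close>
  let ?z0 = "g $ 0 * f1 $ 1 / b $ 0"
  have "\<exists>c. g * f1 - fps_X * (fps_const ?z0 * b) = (fps_X ^ 2 * g * f1) * (even_gf c oo s)"
  proof (rule ex_even_quotient[where n = 3])
    have "odd_fps (g * f1 - fps_X * (fps_const ?z0 * b))"
      by (simp add: odd_fps_iff_compose_uminus_X compose_uminus_X_simps)
    moreover have "(g * f1 - fps_X * (fps_const ?z0 * b)) $ 1 = 0"
      using b0 by (simp add: fps_mult_nth f_nth_0)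
    moreover have "even i \<or> i = 1" if "i < 3" for i :: nat
      using that by presburger
    ultimately show "(g * f1 - fps_X * (fps_const ?z0 * b)) $ i = 0" if "i < 3" for i
      using that unfolding odd_fps_def by blast
  qed (use nonzero in \<open>simp_all add: odd_fps_iff_compose_uminus_X compose_uminus_X_simps
      subdegree_g subdegree_f1 fps_X_power_subdegree\<close>)
  then obtain c where c: "g * f1 - fps_X * (fps_const ?z0 * b) = (fps_X ^ 2 * g * f1) * (even_gf c oo s)"
    by blast
  \<comment> \<open>Prepending \<open>?z0\<close> makes \<open>c\<close> the shifted tail that the
    series identity asks for.\<close>
  have "is_Z2_seq d (case_nat ?z0 c)"
    unfolding is_Z2_seq_iff using c by (simp add: algebra_simps)
  then show ?thesis by blast
qed

lemma ex_W_seq: "\<exists>w. is_W_seq d w"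
proof -
  \<comment> \<open>This value cancels the coefficient of t^2 in \<open>?q\<close>. As
    \<open>?q\<close> is even without constant term, its order is then at least 4, the order of
    \<open>fps_X ^ 3 * g * f1\<close>.\<close>
  let ?w0 = "b $ 2 / b $ 0"
  let ?q = "b - fps_const (b $ 0) - fps_X ^ 2 * (fps_const ?w0 * b)"
  have "\<exists>c. ?q = (fps_X ^ 3 * g * f1) * (even_gf c oo s)"
  proof (rule ex_even_quotient[where n = 4])
    have "even_fps ?q"
      by (simp add: even_fps_iff_compose_uminus_X compose_uminus_X_simps)
    moreover have "?q $ 0 = 0" "?q $ 2 = 0"
      using b0 by (simp_all add: fps_X_power_mult_nth)
    moreover have "odd i \<or> i = 0 \<or> i = 2" if "i < 4" for i :: nat
      using that by presburger
    ultimately show "?q $ i = 0" if "i < 4" for i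
      using that unfolding even_fps_def by blast
  qed (use nonzero in \<open>simp_all add: even_fps_iff_compose_uminus_X compose_uminus_X_simps
      subdegree_g subdegree_f1 fps_X_power_subdegree\<close>)
  then obtain c where c: "?q = (fps_X ^ 3 * g * f1) * (even_gf c oo s)"
    by blast
  have "is_W_seq d (case_nat ?w0 c)"
    unfolding is_W_seq_iff using c by (simp add: algebra_simps power3_eq_cube power2_eq_square)
  then show ?thesis by blast
qed

section \<open>Closed forms of the generating functions\<close>

lemma A_seq_gf:
  assumes "is_A_seq d a"
  shows "even_gf a = fps_X ^ 2 / h ^ 2"
proof -
  have "fps_X ^ 2 = h ^ 2 * even_gf a"
    using compose_h_cong[OF assms[unfolded is_A_seq_iff]] by (simp add: compose_h_simps)
  then show ?thesis using h_nonzero by simp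
qed

lemma Z1_seq_gf:
  assumes "is_Z1_seq d z"
  shows "even_gf z = (1 - fps_const (g $ 0) / (g oo h)) / h ^ 2"
proof -
  have "g oo h = fps_const (g $ 0) + h ^ 2 * (g oo h) * even_gf z"
    using compose_h_cong[OF assms[unfolded is_Z1_seq_iff]] by (simp add: compose_h_simps)
  then have "fps_const (g $ 0) = (g oo h) * (1 - h ^ 2 * even_gf z)"
    by (simp add: algebra_simps)
  then have "fps_const (g $ 0) / (g oo h) = 1 - h ^ 2 * even_gf z"
    using g_compose_h_nonzero by simp
  then show ?thesis using h_nonzero by simp
qed

text \<open>Splitting off the coefficient of index 0 and substituting \<open>s\<close> turns
  \<open>fps_X ^ 2\<close> into \<open>s ^ 2\<close>. This lets the shifted tail be eliminated in
  favour of the full generating function.\<close>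

lemma even_gf_compose_s:
  "even_gf c oo s = fps_const (c 0) + f1 * f2 * (even_gf (\<lambda>j. c (Suc j)) oo s)"
  by (subst even_gf_Suc)
     (simp add: s_square[symmetric] fps_compose_add_distrib fps_compose_mult_distrib[OF s_nth(1)]
       fps_compose_power[OF s_nth(1), symmetric] s_nth)

lemma Z2_seq_gf:
  assumes "is_Z2_seq d z"
  shows "even_gf z = fps_const (g $ 0 * f1 $ 1 / b $ 0) + fps_X ^ 2 / h ^ 2
    - (fps_const (g $ 0 * f1 $ 1) * (b oo h) * (f2 oo h)) / (fps_const (b $ 0) * h * (g oo h))"
proof -
  define Q where "Q = even_gf (\<lambda>j. z (Suc j)) oo s"
  have eq: "g * f1 = fps_X * (fps_const (z 0) * b) + fps_X ^ 2 * g * f1 * Q"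
    using assms unfolding is_Z2_seq_iff Q_def .
  from arg_cong[OF this, of "\<lambda>F. F $ 1"] have z0: "g $ 0 * f1 $ 1 = z 0 * b $ 0"
    by (simp add: fps_mult_nth f_nth_0 mult.assoc fps_X_power_mult_nth)
  \<comment> \<open>Multiplying by \<open>f2\<close> completes \<open>f1 * Q\<close> to
    \<open>f1 * f2 * Q\<close>, which is the full generating function at \<open>s\<close> minus its
    constant term.\<close>
  have "g * s ^ 2 = f2 * (g * f1)"
    by (simp add: s_square)
  also have "\<dots> = fps_X * fps_const (z 0) * b * f2 + fps_X ^ 2 * g * (f1 * f2 * Q)"
    by (subst eq) (simp add: algebra_simps)
  also have "f1 * f2 * Q = (even_gf z oo s) - fps_const (z 0)"
    by (simp add: even_gf_compose_s[of z] Q_def)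
  finally have "g * s ^ 2 = fps_X * fps_const (z 0) * b * f2
      + fps_X ^ 2 * g * ((even_gf z oo s) - fps_const (z 0))" .
  from compose_h_cong[OF this] have "(g oo h) * fps_X ^ 2 = h * fps_const (z 0) * (b oo h) * (f2 oo h)
      + h ^ 2 * (g oo h) * (even_gf z - fps_const (z 0))"
    by (simp add: compose_h_simps)
  \<comment> \<open>The cofactor \<open>A\<close>, supplied by an existing A-sequence, makes
    \<open>fps_X ^ 2 / h ^ 2\<close> an exact quotient and allows a factor \<open>h\<close> to be
    cancelled.\<close>
  moreover obtain A where A: "fps_X ^ 2 = h ^ 2 * A"
  proof -
    obtain a where "s ^ 2 = fps_X ^ 2 * (even_gf a oo s)"
      using ex_A_seq unfolding is_A_seq_iff by blast
    from compose_h_cong[OF this] show thesis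
      by (intro that[of "even_gf a"]) (simp add: compose_h_simps)
  qed
  ultimately have "(g oo h) * (h ^ 2 * A) = h * fps_const (z 0) * (b oo h) * (f2 oo h)
      + h ^ 2 * (g oo h) * (even_gf z - fps_const (z 0))"
    by simp
  then have "h * (fps_const (z 0) * (b oo h) * (f2 oo h)) =
      h * (h * (g oo h) * (fps_const (z 0) + A - even_gf z))"
    by (simp add: algebra_simps power2_eq_square)
  then have "fps_const (z 0) * (b oo h) * (f2 oo h) =
      h * (g oo h) * (fps_const (z 0) + A - even_gf z)"
    using h_nonzero by (simp only: mult_cancel_left) simp
  \<comment> \<open>The factor \<open>b $ 0\<close> turns \<open>z 0\<close> into the known product
    \<open>g $ 0 * f1 $ 1\<close> and produces the denominator of the claim.\<close>
  from arg_cong[OF this, of "(*) (fps_const (b $ 0))"]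
  have "fps_const (g $ 0 * f1 $ 1) * (b oo h) * (f2 oo h) =
      (fps_const (b $ 0) * h * (g oo h)) * (fps_const (z 0) + A - even_gf z)"
    unfolding z0 fps_const_mult[symmetric] by (simp only: mult_ac)
  then have "(fps_const (g $ 0 * f1 $ 1) * (b oo h) * (f2 oo h)) / (fps_const (b $ 0) * h * (g oo h))
      = fps_const (z 0) + A - even_gf z"
    using b0 h_nonzero g_compose_h_nonzero by simp
  moreover have "fps_X ^ 2 / h ^ 2 = A"
    using A h_nonzero by simp
  moreover have "g $ 0 * f1 $ 1 / b $ 0 = z 0"
    using z0 b0 by simp
  ultimately show ?thesis by simp
qed

text \<open>In row 2 the tail contributes nothing, as its factor \<open>fps_X ^ 3 * g * f1\<close>
  has order 4.\<close>

lemma W_seq_nth_0: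
  assumes "is_W_seq d w"
  shows "w 0 = b $ 2 / b $ 0"
  using arg_cong[OF assms[unfolded is_W_seq_iff], of "\<lambda>F. F $ 2"] b0
  by (simp add: fps_X_power_mult_nth mult.assoc)

lemma W_seq_gf:
  assumes "is_W_seq d w"
  shows "even_gf w = ((f2 oo h) * ((1 - fps_const (w 0) * h ^ 2) * (b oo h) - fps_const (b $ 0)))
    / (h ^ 3 * (g oo h)) + fps_const (w 0)"
proof -
  define Q where "Q = even_gf (\<lambda>j. w (Suc j)) oo s"
  have "b = fps_const (b $ 0) + fps_X ^ 2 * (fps_const (w 0) * b + fps_X * g * f1 * Q)"
    using assms unfolding is_W_seq_iff Q_def .
  then have "(1 - fps_const (w 0) * fps_X ^ 2) * b - fps_const (b $ 0) = fps_X ^ 3 * g * f1 * Q"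
    by (simp add: algebra_simps power2_eq_square power3_eq_cube)
  \<comment> \<open>As for \<open>Z2\<close>, the factor \<open>f2\<close> completes
    \<open>f1 * Q\<close> so that the tail can be replaced by the full series.\<close>
  then have "f2 * ((1 - fps_const (w 0) * fps_X ^ 2) * b - fps_const (b $ 0)) =
      fps_X ^ 3 * g * (f1 * f2 * Q)"
    by simp
  also have "f1 * f2 * Q = (even_gf w oo s) - fps_const (w 0)"
    by (simp add: even_gf_compose_s[of w] Q_def)
  finally have "f2 * ((1 - fps_const (w 0) * fps_X ^ 2) * b - fps_const (b $ 0)) =
      fps_X ^ 3 * g * ((even_gf w oo s) - fps_const (w 0))" .
  from compose_h_cong[OF this] have "(f2 oo h) * ((1 - fps_const (w 0) * h ^ 2) * (b oo h) - fps_const (b $ 0)) =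
      (h ^ 3 * (g oo h)) * (even_gf w - fps_const (w 0))"
    by (simp add: compose_h_simps)
  then show ?thesis
    using h_nonzero g_compose_h_nonzero by simp
qed

end

theorem theorem3p1:
  fixes b g f1 f2 s h :: "'a::field_char_0 fps"
    and d :: "nat \<Rightarrow> nat \<Rightarrow> 'a"
  assumes "even_fps b" and "b $ 0 \<noteq> 0"
    and "even_fps g" and "g $ 0 \<noteq> 0"
    and "odd_fps f1" and "f1 $ 1 \<noteq> 0"
    and "odd_fps f2" and "f2 $ 1 \<noteq> 0"
    and "odd_fps s" and "subdegree s = 1" and "s ^ 2 = f1 * f2"
    and "h = fps_inv s"
    and "d = dar_array b g f1 f2"
  shows "(\<exists>a. is_A_seq d a) \<and> (\<exists>z1. is_Z1_seq d z1) \<and>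
         (\<exists>z2. is_Z2_seq d z2) \<and> (\<exists>w. is_W_seq d w) \<and>
         (\<forall>a. is_A_seq d a \<longrightarrow> even_gf a = fps_X ^ 2 / h ^ 2) \<and>
         (\<forall>z1. is_Z1_seq d z1 \<longrightarrow>
            even_gf z1 = (1 - fps_const (g $ 0) / (g oo h)) / h ^ 2) \<and>
         (\<forall>z2. is_Z2_seq d z2 \<longrightarrow>
            even_gf z2 = fps_const (g $ 0 * f1 $ 1 / b $ 0) + fps_X ^ 2 / h ^ 2
              - (fps_const (g $ 0 * f1 $ 1) * (b oo h) * (f2 oo h))
                / (fps_const (b $ 0) * h * (g oo h))) \<and>
         (\<forall>w. is_W_seq d w \<longrightarrow>
            w 0 = b $ 2 / b $ 0 \<and>
            even_gf w = ((f2 oo h) * ((1 - fps_const (w 0) * h ^ 2) * (b oo h) - fps_const (b $ 0)))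
                / (h ^ 3 * (g oo h)) + fps_const (w 0))"
proof -
  interpret double_almost_Riordan b g f1 f2 s
    by unfold_locales (fact assms)+
  show ?thesis
    unfolding assms(12,13)
    by (intro conjI allI impI ex_A_seq ex_Z1_seq ex_Z2_seq ex_W_seq A_seq_gf Z1_seq_gf Z2_seq_gf
        W_seq_nth_0 W_seq_gf)
qed

end
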